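(* Let $\mathbb{F}\subseteq\mathbb{C}$ be a subfield invariant under complex conjugation, and let $(C(z),D(z))$ be a pseudoidentity matrix pair of rank $2$ over $\mathbb{F}$. With $t=z^{-1}$, write $$C(t)=\begin{pmatrix}a&b\\ c&d\end{pmatrix},\qquad a,b,c,d\in\mathbb{F}[t],$$ and assume $bc\neq 0$ and $\deg(a)\le\deg(c)$. Let the Euclidean algorithm applied to $c$ and $a$ be $$c=q_1a+r_1,\quad a=q_2r_1+r_2,\quad\ldots,\quad r_{n-2}=q_nr_{n-1}+r_n,\quad r_{n-1}=q_{n+1}r_n,$$ with $\deg(r_1)<\deg(a)$ and $\deg(r_{k})<\deg(r_{k-1})$ for $2\le k\le n$, and let $$C(t)=(I_2+q_1E_{21})(I_2+q_2E_{12})\cdots(I_2+q_{n+1}E_{uv})(I_2+g(t)E_{rs})C^{\prime}$$ be the resulting factorization of $C(t)$ described in the context, where $g(t)\in\mathbb{F}[t]$ and $C^{\prime}$ is a constant matrix. Then $C(z)$ can be factored completely into a product of matrices of the form $$I_2-N+z^{-k}N,\qquad N^2=0,$$ by substituting $z^{-1}$ for $t$ in the factorization $$C(t)=L_{21,q_1}\,L^{\prime}_{12,q_2}\,L^{\prime}_{21,q_3}\cdots L^{\prime}_{uv,q_{n+1}}\,L^{\prime}_{rs,g},$$ where $$L^{\prime}_{12,q_2}=E_{21,q_1(1)}\,L_{12,q_2}\,E_{21,-q_1(1)},$$ $$L^{\prime}_{21,q_3}=E_{21,q_1(1)}E_{12,q_2(1)}\,L_{21,q_3}\,E_{12,-q_2(1)}E_{21,-q_1(1)},$$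 and so on: each $L^{\prime}_{ij,f}$ is the conjugate of the corresponding $L_{ij,f}$ by the product, in order, of the constant matrices $E_{i'j',f'(1)}$ attached to all the preceding factors $I_2+f'(t)E_{i'j'}$ in the factorization of $C(t)$.
   Context: Pseudoidentity matrix pair of rank $m$: a pair of $m\times m$ matrices $C(z)=\sum_{k=0}^{k_c}C_kz^{-k}$, $D(z)=\sum_{k=k_d}^{0}D_kz^{-k}$ ($k_d\le0\le k_c$, $C_k,D_k$ constant $m\times m$ matrices over $\mathbb{F}$) with $C(z)\tilde D(z)=I_m$ and $C(1)=D(1)=I_m$, where $\tilde D(z)=\sum_k D_k^{\ast}z^{k}$ and $^{\ast}$ is conjugate transpose. By abuse of notation $C(t)$ denotes $C(z)$ rewritten in the variable $t=z^{-1}$. $E_{ij}$ is the $2\times2$ matrix with $1$ in position $(i,j)$ and $0$ elsewhere. For $i\neq j$ and $f(t)=a_nt^n+\cdots+a_1t+a_0\in\mathbb{F}[t]$, define $$L_{ij,a_k}=I_2-a_kE_{ij}+t^ka_kE_{ij}\ (1\le k\le n),\qquad L_{ij,f}=L_{ij,f}(t)=L_{ij,a_n}\cdots L_{ij,a_1},\qquad E_{ij,f(1)}=I_2+f(1)E_{ij}$$ (with $L_{ij,f}=I_2$ if $f$ is constant), and likewise $E_{ij,-f(1)}=I_2-f(1)E_{ij}$; so $I_2+f(t)E_{ij}=L_{ij,f}(t)E_{ij,f(1)}$. The factorization of $C(t)$ from the Euclidean algorithm: multiply $C(t)$ on the left successively by $I_2-q_1E_{21}$, $I_2-q_2E_{12}$,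 $I_2-q_3E_{21}$, …, $I_2-q_{n+1}E_{uv}$ (the positions alternate, so $uv=21$ if $n+1$ is odd and $uv=12$ if $n+1$ is even). The result is $\begin{pmatrix} r_n & b_1 \\ 0 & d_1 \end{pmatrix}$ (when $uv=21$) or $\begin{pmatrix} 0 & b_1 \\ {r_n} & d_1 \end{pmatrix}$ (when $uv=12$), with $b_1,d_1\in\mathbb{F}[t]$; since the determinant is $1$, $r_n$ and $d_1$ (respectively $r_n$ and $b_1$) are nonzero elements of $\mathbb{F}$. Multiply on the left by $I_2-g(t)E_{rs}$, where $g=d_1^{-1}b_1$, $rs=12$ in the first case and $g=b_1^{-1}d_1$, $rs=21$ in the second case. The result is the constant matrix $C^{\prime}=\begin{pmatrix} r_n & 0 \\ 0 & d_1 \end{pmatrix}$, respectively $C^{\prime}=\begin{pmatrix} 0 & b_1 \\ {r_n} & 0 \end{pmatrix}$. (Convention: $r_{-1}=c$, $r_0=a$, so $n\ge 0$.) *)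

theory Defs
  imports
    "HOL-Analysis.Analysis"
    "HOL-Computational_Algebra.Computational_Algebra"
begin

definition conj_invariant_subfield :: "complex set \<Rightarrow> bool" where
  "conj_invariant_subfield F \<longleftrightarrow>
     0 \<in> F \<and> 1 \<in> F \<and>
     (\<forall>x\<in>F. \<forall>y\<in>F. x + y \<in> F \<and> x * y \<in> F) \<and>
     (\<forall>x\<in>F. - x \<in> F \<and> inverse x \<in> F \<and> cnj x \<in> F)"

definition matrix_over :: "complex set \<Rightarrow> complex ^ 'n ^ 'm \<Rightarrow> bool" where
  "matrix_over F A \<longleftrightarrow> (\<forall>i j. A $ i $ j \<in> F)"

definition poly_over :: "complex set \<Rightarrow> complex poly \<Rightarrow> bool" where
  "poly_over F p \<longleftrightarrow> (\<forall>k. coeff p k \<in> F)"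

definition conj_transpose :: "complex ^ 'n ^ 'm \<Rightarrow> complex ^ 'm ^ 'n" where
  "conj_transpose A = map_matrix cnj (transpose A)"

text \<open>
  Matrices whose entries are Laurent polynomials in z are taken over the field of formal
  Laurent series with fls_X as z. The following is the matrix A z^k.
\<close>

definition zterm :: "complex ^ 'n ^ 'm \<Rightarrow> int \<Rightarrow> complex fls ^ 'n ^ 'm" where
  "zterm A k = map_matrix (\<lambda>x. fls_const x * fls_X powi k) A"

text \<open>
  The last two conjuncts are C(1) = I and D(1) = I: the value at z = 1 is the sum of the
  coefficient matrices.
\<close>

definition pseudoidentity_pair ::
    "complex set \<Rightarrow> complex fls ^ 'm ^ 'm \<Rightarrow> complex fls ^ 'm ^ 'm \<Rightarrow> bool" where
  "pseudoidentity_pair F C D \<longleftrightarrow>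
     (\<exists>(kc::int) (kd::int) (Cc :: int \<Rightarrow> complex ^ 'm ^ 'm) (Dc :: int \<Rightarrow> complex ^ 'm ^ 'm).
        kd \<le> 0 \<and> 0 \<le> kc \<and>
        (\<forall>k. matrix_over F (Cc k)) \<and> (\<forall>k. matrix_over F (Dc k)) \<and>
        C = (\<Sum>k\<in>{0..kc}. zterm (Cc k) (- k)) \<and>
        D = (\<Sum>k\<in>{kd..0}. zterm (Dc k) (- k)) \<and>
        C ** (\<Sum>k\<in>{kd..0}. zterm (conj_transpose (Dc k)) k) = mat 1 \<and>
        (\<Sum>k\<in>{0..kc}. Cc k) = mat 1 \<and>
        (\<Sum>k\<in>{kd..0}. Dc k) = mat 1)"

text \<open>Substitution of z^{-1} for t in a polynomial, respectively a polynomial matrix, in t.\<close>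

definition subst_zinv :: "complex poly \<Rightarrow> complex fls" where
  "subst_zinv p = poly (map_poly fls_const p) (fls_X powi (- 1))"

definition msubst_zinv :: "complex poly ^ 'n ^ 'm \<Rightarrow> complex fls ^ 'n ^ 'm" where
  "msubst_zinv A = map_matrix subst_zinv A"

definition const_matrix :: "complex ^ 'n ^ 'm \<Rightarrow> complex poly ^ 'n ^ 'm" where
  "const_matrix A = map_matrix (\<lambda>x. [:x:]) A"

text \<open>Ordered matrix product (the type class product on vectors is the componentwise one).\<close>

definition mprod :: "('a::semiring_1 ^ 'n ^ 'n) list \<Rightarrow> 'a ^ 'n ^ 'n" where
  "mprod As = foldr (**) As (mat 1)"

definition mat2 :: "'a::zero \<Rightarrow> 'a \<Rightarrow> 'a \<Rightarrow> 'a \<Rightarrow> 'a ^ 2 ^ 2" where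
  "mat2 a b c d = vector [vector [a, b], vector [c, d]]"

text \<open>The matrix x E_{ij}.\<close>

definition E_scaled :: "2 \<Rightarrow> 2 \<Rightarrow> 'a::zero \<Rightarrow> 'a ^ 2 ^ 2" where
  "E_scaled i j x = axis i (axis j x)"

text \<open>I + f E_{ij}; E_{ij,f(1)} is obtained from the constant polynomial f(1).\<close>

definition elem_mat :: "2 \<Rightarrow> 2 \<Rightarrow> complex poly \<Rightarrow> complex poly ^ 2 ^ 2" where
  "elem_mat i j f = mat 1 + E_scaled i j f"

definition L_coeff :: "2 \<Rightarrow> 2 \<Rightarrow> nat \<Rightarrow> complex \<Rightarrow> complex poly ^ 2 ^ 2" where
  "L_coeff i j k x = mat 1 - E_scaled i j [:x:] + E_scaled i j (monom x k)"

definition L_mat :: "2 \<Rightarrow> 2 \<Rightarrow> complex poly \<Rightarrow> complex poly ^ 2 ^ 2" where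
  "L_mat i j f = mprod (map (\<lambda>k. L_coeff i j k (coeff f k)) (rev [1..<degree f + 1]))"

text \<open>
  The k-th elementary factor (counting from 1) has its off-diagonal entry in position 21 for
  odd k and 12 for even k.  In particular the (n+1)-st position is uv and the (n+2)-nd is rs.
\<close>

definition prow :: "nat \<Rightarrow> 2" where
  "prow k = (if odd k then 2 else 1)"

definition pcol :: "nat \<Rightarrow> 2" where
  "pcol k = (if odd k then 1 else 2)"

text \<open>
  L' for the k-th factor, where f l is the polynomial of the l-th factor: L for that factor,
  conjugated by the product of E_{ij,f_l(1)} over l = 1, ..., k - 1; the inverse of that
  product is written out.
\<close>

definition L_conj :: "(nat \<Rightarrow> complex poly) \<Rightarrow> nat \<Rightarrow> complex poly ^ 2 ^ 2" where
  "L_conj f k =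
     mprod (map (\<lambda>l. elem_mat (prow l) (pcol l) [:poly (f l) 1:]) [1..<k])
     ** L_mat (prow k) (pcol k) (f k)
     ** mprod (map (\<lambda>l. elem_mat (prow l) (pcol l) [:- poly (f l) 1:]) (rev [1..<k]))"

definition euclidean_algorithm ::
    "complex set \<Rightarrow> complex poly \<Rightarrow> complex poly \<Rightarrow> nat \<Rightarrow> (nat \<Rightarrow> complex poly) \<Rightarrow>
     (int \<Rightarrow> complex poly) \<Rightarrow> bool" where
  "euclidean_algorithm F c a n q r \<longleftrightarrow>
     (\<forall>k\<in>{1..n+1}. poly_over F (q k)) \<and> (\<forall>k\<in>{1..n}. poly_over F (r (int k))) \<and>
     r (- 1) = c \<and> r 0 = a \<and>
     (\<forall>k\<in>{1..n}. r (int k - 2) = q k * r (int k - 1) + r (int k) \<and>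
                 degree (r (int k)) < degree (r (int k - 1))) \<and>
     r (int n - 1) = q (n + 1) * r (int n)"

text \<open>A is a product of matrices I - N + z^{-k} N with N^2 = 0, k positive and N over F.\<close>

definition factors_completely :: "complex set \<Rightarrow> complex fls ^ 2 ^ 2 \<Rightarrow> bool" where
  "factors_completely F A \<longleftrightarrow>
     (\<exists>kNs :: (nat \<times> (complex ^ 2 ^ 2)) list.
        (\<forall>(k, N) \<in> set kNs. 1 \<le> k \<and> matrix_over F N \<and> N ** N = 0) \<and>
        A = mprod (map (\<lambda>(k, N). mat 1 - zterm N 0 + zterm N (- int k)) kNs))"

end

theory Submission
  imports Defs
begin

text \<open>
  Since C(t) and its inverse are both polynomial in t, det C is a nonzero constant, and it is 1
  because C(1) = I. The Euclidean algorithm therefore reduces C(t) to a constant matrix C'.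
  Writing each elementary factor as L E with E its value at t = 1 and moving every E to the right
  turns each L into its conjugate L' and leaves the product of all E times C' at the end; that
  product is C(1) = I. Each L' is a product of conjugates of I - N + t^k N with N^2 = 0,
  and conjugation preserves this form.
\<close>

section \<open>Ordered products and entrywise ring homomorphisms\<close>

lemma mprod_Nil [simp]: "mprod [] = mat 1"
  and mprod_Cons [simp]: "mprod (A # As) = A ** mprod As"
  by (simp_all add: mprod_def)

lemma mprod_append [simp]: "mprod (As @ Bs) = mprod As ** mprod Bs"
  by (induction As) (simp_all add: matrix_mul_assoc)

text \<open>Reversing the second list makes the factors cancel in pairs from the middle
  outwards.\<close>

lemma mprod_inverse:
  fixes A B :: "'b \<Rightarrow> 'a::semiring_1 ^ 'n ^ 'n"
  assumes "\<And>x. x \<in> set xs \<Longrightarrow> A x ** B x = mat 1"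
  shows "mprod (map A xs) ** mprod (map B (rev xs)) = mat 1"
  using assms
proof (induction xs)
  case (Cons x xs)
  have "mprod (map A (x # xs)) ** mprod (map B (rev (x # xs))) =
      A x ** (mprod (map A xs) ** mprod (map B (rev xs))) ** B x"
    by (simp add: matrix_mul_assoc)
  then show ?case using Cons by simp
qed simp

text \<open>\<open>P' ** P\<close> is the identity and can be inserted between neighbouring factors;
  the other inverse law covers the empty product.\<close>

lemma mprod_conjugate:
  fixes P P' :: "'a::semiring_1 ^ 'n ^ 'n"
  assumes "P ** P' = mat 1" "P' ** P = mat 1"
  shows "P ** mprod As ** P' = mprod (map (\<lambda>A. P ** A ** P') As)"
proof (induction As)
  case (Cons A As)
  have "P ** mprod (A # As) ** P' = P ** A ** (P' ** P) ** mprod As ** P'"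
    by (simp add: assms matrix_mul_assoc)
  also have "\<dots> = (P ** A ** P') ** (P ** mprod As ** P')"
    by (simp only: matrix_mul_assoc)
  finally show ?case using Cons by simp
qed (simp add: assms)

lemma matrix_add_rdistrib: "(A + B) ** C = A ** C + B ** (C :: 'a::semiring_1 ^ 'n ^ 'm)"
  by (simp add: vec_eq_iff matrix_matrix_mult_def distrib_right sum.distrib)

text \<open>Three maps are treated alike: the embedding of constants into polynomials, evaluation at
  a point, and substitution of z^{-1} for t. Each must commute with ordered matrix products when
  applied entrywise.\<close>

locale ring_morphism =
  fixes h :: "'a::comm_ring_1 \<Rightarrow> 'b::comm_ring_1"
  assumes add: "h (x + y) = h x + h y"
    and mult: "h (x * y) = h x * h y"
    and one: "h 1 = 1"
begin

lemma zero: "h 0 = 0"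
  using add [of 0 0] by simp

lemma sum: "h (\<Sum>x\<in>A. u x) = (\<Sum>x\<in>A. h (u x))"
  by (induction A rule: infinite_finite_induct) (simp_all add: zero add)

lemma map_matrix_mult: "map_matrix h (A ** B) = map_matrix h A ** map_matrix h B"
  by (simp add: vec_eq_iff matrix_matrix_mult_def sum mult)

lemma map_matrix_one: "map_matrix h (mat 1) = mat 1"
  by (simp add: vec_eq_iff mat_def zero one)

lemma map_matrix_mprod: "map_matrix h (mprod As) = mprod (map (map_matrix h) As)"
  by (induction As) (simp_all add: map_matrix_mult map_matrix_one)

lemma map_matrix_sum: "map_matrix h (\<Sum>x\<in>S. A x) = (\<Sum>x\<in>S. map_matrix h (A x))"
  by (simp add: vec_eq_iff sum)

lemma map_matrix_add: "map_matrix h (A + B) = map_matrix h A + map_matrix h B"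
  by (simp add: vec_eq_iff add)

lemma map_matrix_diff: "map_matrix h (A - B) = map_matrix h A - map_matrix h B"
proof -
  have "h (x - y) = h x - h y" for x y
    using add [of "x - y" y] by simp
  then show ?thesis by (simp add: vec_eq_iff)
qed

end

interpretation const_poly: ring_morphism "\<lambda>x::'a::comm_ring_1. [:x:]"
  by standard simp_all

interpretation poly_at: ring_morphism "\<lambda>p. poly p x" for x :: "'a::comm_ring_1"
  by standard simp_all

section \<open>Substitution of z^{-1} for t as an injective ring homomorphism\<close>

lemma subst_zinv_0 [simp]: "subst_zinv 0 = 0"
  by (simp add: subst_zinv_def)

lemma subst_zinv_pCons:
  "subst_zinv (pCons x p) = fls_const x + fls_X powi (- 1) * subst_zinv p"
  by (simp add: subst_zinv_def map_poly_pCons)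

lemma subst_zinv_add: "subst_zinv (p + q) = subst_zinv p + subst_zinv q"
  by (induction p q rule: poly_induct2)
    (simp_all add: subst_zinv_pCons algebra_simps flip: fls_plus_const)

lemma subst_zinv_smult: "subst_zinv (smult x p) = fls_const x * subst_zinv p"
  by (induction p) (simp_all add: subst_zinv_pCons algebra_simps flip: fls_const_mult_const)

lemma subst_zinv_mult: "subst_zinv (p * q) = subst_zinv p * subst_zinv q"
  by (induction p)
    (simp_all add: subst_zinv_add subst_zinv_smult subst_zinv_pCons algebra_simps)

interpretation subst_zinv: ring_morphism subst_zinv
  by standard (simp_all add: subst_zinv_add subst_zinv_mult one_pCons subst_zinv_pCons)

lemma fls_nth_subst_zinv: "fls_nth (subst_zinv p) (- int k) = coeff p k"
proof (induction p arbitrary: k)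
  case (pCons x p)
  have shift: "inverse fls_X * u = fls_shift 1 u" for u :: "complex fls"
    by (simp add: fls_inverse_X fls_X_inv_times_conv_shift)
  show ?case
  proof (cases k)
    case 0
    \<comment> \<open>At index 0 the shifted series contributes its coefficient at index 1, which
      vanishes because only nonpositive powers of z occur.\<close>
    have "fls_nth (subst_zinv p) (int (Suc m)) = 0" for m
    proof (induction p arbitrary: m)
      case (pCons a p)
      from pCons.IH [of "Suc m"] show ?case by (simp add: subst_zinv_pCons shift add.commute)
    qed simp
    from this [of 0] 0 show ?thesis by (simp add: subst_zinv_pCons shift)
  next
    case (Suc k')
    then show ?thesis using pCons.IH [of k'] by (simp add: subst_zinv_pCons shift)
  qed
qed simp

lemma msubst_zinv_mult: "msubst_zinv (A ** B) = msubst_zinv A ** msubst_zinv B"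
  and msubst_zinv_one: "msubst_zinv (mat 1) = mat 1"
  and msubst_zinv_mprod: "msubst_zinv (mprod As) = mprod (map msubst_zinv As)"
  and msubst_zinv_sum: "msubst_zinv (\<Sum>x\<in>S. G x) = (\<Sum>x\<in>S. msubst_zinv (G x))"
  and msubst_zinv_add: "msubst_zinv (A + B) = msubst_zinv A + msubst_zinv B"
  and msubst_zinv_diff: "msubst_zinv (A - B) = msubst_zinv A - msubst_zinv B"
  unfolding msubst_zinv_def
  by (rule subst_zinv.map_matrix_mult subst_zinv.map_matrix_one subst_zinv.map_matrix_mprod
      subst_zinv.map_matrix_sum subst_zinv.map_matrix_add subst_zinv.map_matrix_diff)+

text \<open>The coefficients of a polynomial can be read off its image, so identities between
  Laurent matrices pull back to polynomial matrices in t.\<close>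

lemma msubst_zinv_eq_iff: "msubst_zinv A = msubst_zinv B \<longleftrightarrow> A = B"
proof -
  have "p = q" if "subst_zinv p = subst_zinv q" for p q
    by (rule poly_eqI) (metis that fls_nth_subst_zinv)
  then show ?thesis by (auto simp: msubst_zinv_def vec_eq_iff)
qed

lemma subst_zinv_monom: "subst_zinv (monom x k) = fls_const x * fls_X powi (- int k)"
proof (induction k)
  case (Suc k)
  have "fls_X powi (- int (Suc k)) = fls_X powi (- 1) * (fls_X powi (- int k) :: complex fls)"
    by (subst power_int_add [symmetric]) simp_all
  with Suc show ?case by (simp add: monom_Suc subst_zinv_pCons mult.left_commute)
qed (simp add: monom_0 subst_zinv_pCons)

lemma zterm_eq_msubst_zinv:
  "zterm A (- int k) = msubst_zinv (map_matrix (\<lambda>x. monom x k) A)"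
  by (simp add: zterm_def msubst_zinv_def vec_eq_iff subst_zinv_monom)

section \<open>Elementary matrices\<close>

lemma E_scaled_nth: "E_scaled i j x $ k $ l = (if k = i \<and> l = j then x else 0)"
  by (simp add: E_scaled_def axis_def)

lemma elem_mat_nth:
  "elem_mat i j x $ k $ l = (if k = l then 1 else 0) + (if k = i \<and> l = j then x else 0)"
  by (simp add: elem_mat_def E_scaled_nth mat_def)

lemma elem_mat_0 [simp]: "elem_mat i j 0 = mat 1"
  by (simp add: vec_eq_iff elem_mat_nth mat_def)

text \<open>This row-operation form lets one division step of the Euclidean algorithm be read off
  the first column.\<close>

lemma elem_mat_mult_nth:
  "(elem_mat i j x ** A) $ k $ l = A $ k $ l + (if k = i then x * A $ j $ l else 0)"
  using exhaust_2 [of i] exhaust_2 [of j] exhaust_2 [of k]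
  by (auto simp: matrix_matrix_mult_def sum_2 elem_mat_nth algebra_simps)

lemma elem_mat_mult:
  assumes "i \<noteq> j"
  shows "elem_mat i j x ** elem_mat i j y = elem_mat i j (x + y)"
  using assms by (auto simp: vec_eq_iff elem_mat_mult_nth elem_mat_nth)

lemma mprod_elem_mat:
  assumes "i \<noteq> j"
  shows "mprod (map (\<lambda>k. elem_mat i j (u k)) ks) = elem_mat i j (\<Sum>k\<leftarrow>ks. u k)"
  by (induction ks) (simp_all add: elem_mat_mult assms)

lemma det_elem_mat:
  assumes "i \<noteq> j"
  shows "det (elem_mat i j x) = 1"
  using assms exhaust_2 [of i] exhaust_2 [of j] by (auto simp: det_2 elem_mat_nth)

lemma elem_mat_const: "elem_mat i j [:x:] = const_matrix (mat 1 + E_scaled i j x)"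
  by (simp add: vec_eq_iff elem_mat_nth const_matrix_def mat_def E_scaled_nth one_pCons)

lemma L_coeff_eq_elem_mat: "L_coeff i j k x = elem_mat i j (monom x k - [:x:])"
  by (simp add: vec_eq_iff elem_mat_nth L_coeff_def mat_def E_scaled_nth)

text \<open>All factors of \<open>L_mat i j p\<close> share one off-diagonal position, so their
  entries add up: the sum of a_k t^k - a_k over k from 1 to the degree is p - p(1). The constant
  factor supplies the missing p(1).\<close>

lemma L_mat_mult_elem_mat:
  assumes "i \<noteq> j"
  shows "L_mat i j p ** elem_mat i j [:poly p 1:] = elem_mat i j p"
proof -
  let ?u = "\<lambda>k. monom (coeff p k) k - [:coeff p k:]"
  have "(\<Sum>k\<leftarrow>rev [1..<degree p + 1]. ?u k) = (\<Sum>k\<in>{1..<degree p + 1}. ?u k)"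
    by (subst sum_list_distinct_conv_sum_set) (simp_all del: upt_Suc)
  \<comment> \<open>The term for k = 0 is zero, so the range may start at 0.\<close>
  also have "\<dots> = (\<Sum>k\<le>degree p. ?u k)"
    by (rule sum.mono_neutral_left) (auto simp: monom_0 not_le less_Suc_eq_le)
  also have "\<dots> = p - [:poly p 1:]"
    by (simp add: sum_subtractf poly_as_sum_of_monoms poly_altdef const_poly.sum)
  finally have "L_mat i j p = elem_mat i j (p - [:poly p 1:])"
    by (simp only: L_mat_def L_coeff_eq_elem_mat mprod_elem_mat [OF assms])
  then show ?thesis by (simp add: elem_mat_mult assms)
qed

section \<open>Alternating elementary factors and the Euclidean algorithm\<close>

lemma prow_neq_pcol [simp]: "prow k \<noteq> pcol k" "pcol k \<noteq> prow k"
  by (simp_all add: prow_def pcol_def)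

lemma prow_Suc: "prow (Suc k) = pcol k"
  and pcol_Suc: "pcol (Suc k) = prow k"
  by (simp_all add: prow_def pcol_def)

text \<open>Let P be the product of the constants collected so far. The next factor splits as L K,
  and P L K = (P L P^{-1}) (P K): the bracket on the left is L', and the one on the right is the new
  collection of constants.\<close>

lemma mprod_elem_mat_eq_mprod_L_conj:
  "mprod (map (\<lambda>k. elem_mat (prow k) (pcol k) (f k)) [1..<Suc m]) =
   mprod (map (L_conj f) [1..<Suc m]) **
   mprod (map (\<lambda>k. elem_mat (prow k) (pcol k) [:poly (f k) 1:]) [1..<Suc m])"
proof (induction m)
  case (Suc m)
  let ?E = "\<lambda>k. elem_mat (prow k) (pcol k) (f k)"
  let ?K = "\<lambda>k. elem_mat (prow k) (pcol k) [:poly (f k) 1:]"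
  let ?K' = "\<lambda>k. elem_mat (prow k) (pcol k) [:- poly (f k) 1:]"
  let ?P = "mprod (map ?K [1..<Suc m])"
  let ?P' = "mprod (map ?K' (rev [1..<Suc m]))"
  let ?L = "L_mat (prow (Suc m)) (pcol (Suc m)) (f (Suc m))"
  have inv: "?P' ** ?P = mat 1"
    using mprod_inverse [of "rev [1..<Suc m]" ?K' ?K] by (simp add: elem_mat_mult del: upt_Suc)
  have "L_conj f (Suc m) ** (?P ** ?K (Suc m)) = ?P ** ?L ** (?P' ** ?P) ** ?K (Suc m)"
    by (simp only: L_conj_def matrix_mul_assoc)
  also have "\<dots> = ?P ** (?L ** ?K (Suc m))"
    by (simp only: inv matrix_mul_assoc matrix_mul_rid)
  also have "\<dots> = ?P ** ?E (Suc m)"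
    by (simp add: L_mat_mult_elem_mat)
  finally have step: "L_conj f (Suc m) ** (?P ** ?K (Suc m)) = ?P ** ?E (Suc m)" .
  have "mprod (map ?E [1..<Suc (Suc m)]) = mprod (map ?E [1..<Suc m]) ** ?E (Suc m)"
    by simp
  also have "\<dots> = mprod (map (L_conj f) [1..<Suc m]) ** (?P ** ?E (Suc m))"
    by (simp only: Suc matrix_mul_assoc)
  also have "\<dots> = mprod (map (L_conj f) [1..<Suc m]) ** (L_conj f (Suc m) ** (?P ** ?K (Suc m)))"
    by (simp only: step)
  also have "\<dots> = mprod (map (L_conj f) [1..<Suc (Suc m)]) ** mprod (map ?K [1..<Suc (Suc m)])"
    by (simp add: matrix_mul_assoc)
  finally show ?case .
qed simp

text \<open>The first column always holds two consecutive remainders. Step k replaces the older one,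
  s(k-2), by s(k-2) - q_k s(k-1) = s(k), and the row being overwritten alternates.\<close>

lemma euclid_first_column:
  fixes s :: "int \<Rightarrow> complex poly" and A M :: "complex poly ^ 2 ^ 2"
  assumes "\<And>k. 1 \<le> k \<Longrightarrow> k \<le> m \<Longrightarrow> s (int k - 2) = q k * s (int k - 1) + s (int k)"
    and "A $ 1 $ 1 = s 0" "A $ 2 $ 1 = s (- 1)"
    and "M = mprod (map (\<lambda>k. elem_mat (prow k) (pcol k) (- q k)) (rev [1..<Suc m])) ** A"
  shows "M $ prow m $ 1 = s (int m) \<and> M $ pcol m $ 1 = s (int m - 1)"
  using assms(1,4)
proof (induction m arbitrary: M)
  case 0
  then show ?case using assms(2,3) by (simp add: prow_def pcol_def)
next
  case (Suc m)
  define M0 where "M0 = mprod (map (\<lambda>k. elem_mat (prow k) (pcol k) (- q k)) (rev [1..<Suc m])) ** A"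
  have IH: "M0 $ prow m $ 1 = s (int m)" "M0 $ pcol m $ 1 = s (int m - 1)"
    using Suc.IH [OF Suc.prems(1) M0_def] by simp_all
  \<comment> \<open>The list is reversed, so the latest operation stands leftmost; its position is
    that of step m with row and column exchanged.\<close>
  have "M = elem_mat (pcol m) (prow m) (- q (Suc m)) ** M0"
    by (simp add: Suc.prems(2) M0_def matrix_mul_assoc prow_Suc pcol_Suc)
  moreover have "s (int m - 1) = q (Suc m) * s (int m) + s (int (Suc m))"
    using Suc.prems(1) [of "Suc m"] by (simp add: algebra_simps)
  ultimately show ?case
    by (simp add: elem_mat_mult_nth IH prow_Suc pcol_Suc)
qed

section \<open>Coefficients in F\<close>

definition matrix_poly_over :: "complex set \<Rightarrow> complex poly ^ 'n ^ 'm \<Rightarrow> bool" where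
  "matrix_poly_over F A \<longleftrightarrow> (\<forall>i j. poly_over F (A $ i $ j))"

context
  fixes F :: "complex set"
  assumes F: "conj_invariant_subfield F"
begin

lemma F_closed:
  shows "0 \<in> F" "1 \<in> F" "x \<in> F \<Longrightarrow> y \<in> F \<Longrightarrow> x + y \<in> F" "x \<in> F \<Longrightarrow> y \<in> F \<Longrightarrow> x * y \<in> F"
    "x \<in> F \<Longrightarrow> - x \<in> F" "x \<in> F \<Longrightarrow> inverse x \<in> F"
  using F by (auto simp: conj_invariant_subfield_def)

lemma F_sum: "(\<And>x. x \<in> A \<Longrightarrow> u x \<in> F) \<Longrightarrow> (\<Sum>x\<in>A. u x) \<in> F"
  by (induction A rule: infinite_finite_induct) (auto simp: F_closed)

lemma F_power: "x \<in> F \<Longrightarrow> x ^ k \<in> F"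
  by (induction k) (auto simp: F_closed)

lemma poly_over_sum:
  "(\<And>x. x \<in> A \<Longrightarrow> poly_over F (u x)) \<Longrightarrow> poly_over F (\<Sum>x\<in>A. u x)"
  by (auto simp: poly_over_def coeff_sum intro!: F_sum)

lemma poly_over_mult: "poly_over F p \<Longrightarrow> poly_over F q \<Longrightarrow> poly_over F (p * q)"
  by (auto simp: poly_over_def coeff_mult intro!: F_sum F_closed)

lemma poly_in_F: "poly_over F p \<Longrightarrow> x \<in> F \<Longrightarrow> poly p x \<in> F"
  by (auto simp: poly_over_def poly_altdef intro!: F_sum F_closed F_power)

lemma matrix_poly_over_mult:
  "matrix_poly_over F A \<Longrightarrow> matrix_poly_over F B \<Longrightarrow> matrix_poly_over F (A ** B)"
  by (auto simp: matrix_poly_over_def matrix_matrix_mult_def intro!: poly_over_sum poly_over_mult)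

lemma matrix_poly_over_elem_mat: "poly_over F p \<Longrightarrow> matrix_poly_over F (elem_mat i j p)"
  by (auto simp: matrix_poly_over_def elem_mat_nth poly_over_def F_closed)

lemma matrix_poly_over_mprod:
  "(\<And>A. A \<in> set As \<Longrightarrow> matrix_poly_over F A) \<Longrightarrow> matrix_poly_over F (mprod As)"
proof (induction As)
  case Nil
  show ?case by (auto simp: matrix_poly_over_def mat_def poly_over_def F_closed)
qed (auto intro: matrix_poly_over_mult)

lemma matrix_over_mult: "matrix_over F A \<Longrightarrow> matrix_over F B \<Longrightarrow> matrix_over F (A ** B)"
  by (auto simp: matrix_over_def matrix_matrix_mult_def intro!: F_sum F_closed)

lemma matrix_over_mprod:
  "(\<And>A. A \<in> set As \<Longrightarrow> matrix_over F A) \<Longrightarrow> matrix_over F (mprod As)"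
proof (induction As)
  case Nil
  show ?case by (auto simp: matrix_over_def mat_def F_closed)
qed (auto intro: matrix_over_mult)

lemma matrix_over_elementary: "x \<in> F \<Longrightarrow> matrix_over F (mat 1 + E_scaled i j x)"
  by (auto simp: matrix_over_def mat_def E_scaled_nth F_closed)

section \<open>Complete factorizations\<close>

lemma factors_completely_mult:
  assumes "factors_completely F A" "factors_completely F B"
  shows "factors_completely F (A ** B)"
proof -
  obtain xs ys where "\<forall>(k, N) \<in> set xs. 1 \<le> k \<and> matrix_over F N \<and> N ** N = 0"
    and "A = mprod (map (\<lambda>(k, N). mat 1 - zterm N 0 + zterm N (- int k)) xs)"
    and "\<forall>(k, N) \<in> set ys. 1 \<le> k \<and> matrix_over F N \<and> N ** N = 0"
    and "B = mprod (map (\<lambda>(k, N). mat 1 - zterm N 0 + zterm N (- int k)) ys)"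
    using assms unfolding factors_completely_def by blast
  then show ?thesis
    unfolding factors_completely_def by (intro exI [of _ "xs @ ys"]) auto
qed

lemma factors_completely_mprod:
  "(\<And>A. A \<in> set As \<Longrightarrow> factors_completely F A) \<Longrightarrow> factors_completely F (mprod As)"
proof (induction As)
  case Nil
  show ?case unfolding factors_completely_def by (intro exI [of _ "[]"]) simp
qed (auto intro: factors_completely_mult)

text \<open>The matrix in the middle is I + (t^k - 1) x E_ij. Conjugation by constants turns it into
  I + (t^k - 1) N with N = P x E_ij P', and N squares to zero because P' P = I and E_ij does so for
  distinct i and j.\<close>

lemma factors_completely_conj_L_coeff:
  assumes "1 \<le> k" "x \<in> F" "i \<noteq> j" "matrix_over F P" "matrix_over F P'"
    and inv: "P ** P' = mat 1" "P' ** P = mat 1"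
  shows "factors_completely F (msubst_zinv (const_matrix P ** L_coeff i j k x ** const_matrix P'))"
proof -
  define N where "N = P ** E_scaled i j x ** P'"
  have "E_scaled i j x ** E_scaled i j x = (0 :: complex ^ 2 ^ 2)"
    using \<open>i \<noteq> j\<close> by (auto simp: vec_eq_iff matrix_matrix_mult_def E_scaled_nth intro!: sum.neutral)
  moreover have "N ** N = P ** E_scaled i j x ** (P' ** P) ** E_scaled i j x ** P'"
    by (simp only: N_def matrix_mul_assoc)
  ultimately have sq: "N ** N = 0"
    by (simp add: inv flip: matrix_mul_assoc)
  have over: "matrix_over F N"
    unfolding N_def using assms
    by (intro matrix_over_mult) (auto simp: matrix_over_def E_scaled_nth F_closed)
  \<comment> \<open>\<open>?S A\<close> is (t^k - 1) A; the scalar factor commutes with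
    multiplication by constant matrices.\<close>
  let ?S = "\<lambda>A :: complex ^ 2 ^ 2. map_matrix (\<lambda>y. smult y (monom 1 k - 1)) A"
  have S: "const_matrix P ** ?S A ** const_matrix P' = ?S (P ** A ** P')" for A
    by (simp add: vec_eq_iff matrix_matrix_mult_def const_matrix_def poly_eq_iff
        coeff_sum sum_distrib_left sum_distrib_right mult_ac)
  have "L_coeff i j k x = mat 1 + ?S (E_scaled i j x)"
    by (simp add: vec_eq_iff L_coeff_def mat_def E_scaled_nth left_diff_distrib smult_diff_right smult_monom)
  then have "const_matrix P ** L_coeff i j k x ** const_matrix P' =
      const_matrix P ** const_matrix P' + ?S N"
    by (simp add: matrix_add_ldistrib matrix_add_rdistrib S N_def)
  also have "const_matrix P ** const_matrix P' = mat 1"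
    unfolding const_matrix_def
    by (simp add: inv const_poly.map_matrix_one flip: const_poly.map_matrix_mult)
  also have "mat 1 + ?S N =
      mat 1 - map_matrix (\<lambda>y. monom y 0) N + map_matrix (\<lambda>y. monom y k) N"
    by (simp add: vec_eq_iff left_diff_distrib smult_diff_right smult_monom monom_0)
  finally have "msubst_zinv (const_matrix P ** L_coeff i j k x ** const_matrix P') =
      mat 1 - zterm N 0 + zterm N (- int k)"
    using zterm_eq_msubst_zinv [of N 0]
    by (simp add: zterm_eq_msubst_zinv msubst_zinv_add msubst_zinv_diff msubst_zinv_one)
  then show ?thesis
    unfolding factors_completely_def using assms(1) sq over
    by (intro exI [of _ "[(k, N)]"]) simp
qed

text \<open>The conjugating products are constant matrices over F with mutually inverse values, so
  conjugation distributes over the factors of \<open>L_mat\<close> and each is handled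
  separately.\<close>

lemma factors_completely_L_conj:
  assumes "\<And>l. 1 \<le> l \<Longrightarrow> l \<le> k \<Longrightarrow> poly_over F (f l)" "1 \<le> k"
  shows "factors_completely F (msubst_zinv (L_conj f k))"
proof -
  let ?K = "\<lambda>l. mat 1 + E_scaled (prow l) (pcol l) (poly (f l) 1)"
  let ?K' = "\<lambda>l. mat 1 + E_scaled (prow l) (pcol l) (- poly (f l) 1)"
  define P P' where "P = mprod (map ?K [1..<k])" and "P' = mprod (map ?K' (rev [1..<k]))"
  have KK: "?K l ** ?K' l = mat 1" "?K' l ** ?K l = mat 1" for l
    by (auto simp: prow_def pcol_def vec_eq_iff matrix_matrix_mult_def sum_2 forall_2 E_scaled_nth mat_def)
  have inv: "P ** P' = mat 1" "P' ** P = mat 1"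
    unfolding P_def P'_def using mprod_inverse [of "[1..<k]" ?K ?K']
      mprod_inverse [of "rev [1..<k]" ?K' ?K] KK by auto
  have const: "const_matrix P = mprod (map (\<lambda>l. elem_mat (prow l) (pcol l) [:poly (f l) 1:]) [1..<k])"
    "const_matrix P' = mprod (map (\<lambda>l. elem_mat (prow l) (pcol l) [:- poly (f l) 1:]) (rev [1..<k]))"
    unfolding P_def P'_def elem_mat_const
    by (simp_all add: const_matrix_def const_poly.map_matrix_mprod comp_def)
  have over: "matrix_over F P" "matrix_over F P'"
    unfolding P_def P'_def using assms
    by (auto intro!: matrix_over_mprod matrix_over_elementary F_closed poly_in_F)
  have inv': "const_matrix P ** const_matrix P' = mat 1" "const_matrix P' ** const_matrix P = mat 1"
    unfolding const_matrix_def
    by (simp_all add: inv const_poly.map_matrix_one flip: const_poly.map_matrix_mult)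
  have "L_conj f k = const_matrix P ** L_mat (prow k) (pcol k) (f k) ** const_matrix P'"
    by (simp only: L_conj_def const)
  also have "\<dots> = mprod (map (\<lambda>l. const_matrix P ** L_coeff (prow k) (pcol k) l (coeff (f k) l) **
      const_matrix P') (rev [1..<degree (f k) + 1]))"
    by (simp add: L_mat_def mprod_conjugate [OF inv'] comp_def)
  finally have "msubst_zinv (L_conj f k) = mprod (map (\<lambda>l. msubst_zinv (const_matrix P **
      L_coeff (prow k) (pcol k) l (coeff (f k) l) ** const_matrix P')) (rev [1..<degree (f k) + 1]))"
    by (simp add: msubst_zinv_mprod comp_def)
  moreover have "coeff (f k) l \<in> F" for l
    using assms by (auto simp: poly_over_def)
  ultimately show ?thesis
    using over inv by (auto intro!: factors_completely_mprod factors_completely_conj_L_coeff simp del: upt_Suc)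
qed

section \<open>Pseudoidentity pairs in the variable t\<close>

text \<open>This carries the Laurent definition over to t. Both C and its right inverse are
  polynomial in t, so det C is a unit and hence constant.\<close>

lemma pseudoidentity_pair_poly:
  fixes Ct :: "complex poly ^ 'm ^ 'm"
  assumes "pseudoidentity_pair F (msubst_zinv Ct) D"
  shows "matrix_poly_over F Ct" "map_matrix (\<lambda>p. poly p 1) Ct = mat 1" "det Ct = 1"
proof -
  obtain kc kd Cc Dc where
    over: "\<And>k::int. matrix_over F (Cc k)" and
    C: "msubst_zinv Ct = (\<Sum>k\<in>{0..kc}. zterm (Cc k) (- k))" and
    CD: "msubst_zinv Ct ** (\<Sum>k\<in>{kd..0::int}. zterm (conj_transpose (Dc k)) k) = mat 1" and
    C1: "(\<Sum>k\<in>{0..kc}. Cc k) = mat 1"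
    using assms unfolding pseudoidentity_pair_def by blast
  \<comment> \<open>Every k in the range is nonnegative, so \<open>nat\<close> truncates
    nothing.\<close>
  have "msubst_zinv Ct = msubst_zinv (\<Sum>k\<in>{0..kc}. map_matrix (\<lambda>x. monom x (nat k)) (Cc k))"
    unfolding msubst_zinv_sum C by (rule sum.cong) (auto simp flip: zterm_eq_msubst_zinv)
  then have Ct: "Ct = (\<Sum>k\<in>{0..kc}. map_matrix (\<lambda>x. monom x (nat k)) (Cc k))"
    by (simp add: msubst_zinv_eq_iff)
  show "matrix_poly_over F Ct"
    using over unfolding Ct matrix_poly_over_def
    by (auto simp: matrix_over_def poly_over_def coeff_sum F_closed intro!: F_sum)
  show ev: "map_matrix (\<lambda>p. poly p 1) Ct = mat 1"
    unfolding Ct C1 [symmetric]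
    by (simp add: vec_eq_iff poly_sum poly_monom)
  \<comment> \<open>The right inverse of C has only powers z^k with k at most 0; rewritten as t^{-k}
    it is a polynomial matrix.\<close>
  define Dt where "Dt = (\<Sum>k\<in>{kd..0}. map_matrix (\<lambda>x. monom x (nat (- k))) (conj_transpose (Dc k)))"
  have "msubst_zinv Dt = (\<Sum>k\<in>{kd..0}. zterm (conj_transpose (Dc k)) k)"
    unfolding msubst_zinv_sum Dt_def by (rule sum.cong) (auto simp flip: zterm_eq_msubst_zinv)
  with CD have "msubst_zinv (Ct ** Dt) = msubst_zinv (mat 1)"
    by (simp add: msubst_zinv_mult msubst_zinv_one)
  then have "det Ct * det Dt = 1"
    by (metis msubst_zinv_eq_iff det_mul det_I)
  then have "is_unit (det Ct)" by (metis dvd_triv_left)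
  then obtain x where x: "det Ct = [:x:]"
    using is_unit_polyE by blast
  \<comment> \<open>Evaluation at t = 1 identifies the constant, since C(1) = I.\<close>
  have "poly (det Ct) 1 = det (map_matrix (\<lambda>p. poly p 1) Ct)"
    by (simp add: det_def poly_sum poly_prod)
  with x ev show "det Ct = 1" by (simp add: one_pCons)
qed

end

section \<open>Reduction of C(t) to a constant matrix and the complete factorization\<close>

theorem theorem4p1:
  fixes F :: "complex set"
    and C D :: "complex fls ^ 2 ^ 2"
    and a b c d g :: "complex poly"
    and Ct M C' :: "complex poly ^ 2 ^ 2"
    and n :: nat
    and q f :: "nat \<Rightarrow> complex poly"
    and r :: "int \<Rightarrow> complex poly"
  assumes F: "conj_invariant_subfield F"
    and CD: "pseudoidentity_pair F C D"
    and Ct: "Ct = mat2 a b c d" "msubst_zinv Ct = C"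
    and bc: "b * c \<noteq> 0"
    and deg: "degree a \<le> degree c"
    and euclid: "euclidean_algorithm F c a n q r"
    and M: "M = mprod (map (\<lambda>k. elem_mat (prow k) (pcol k) (- q k)) (rev [1..<n+2])) ** Ct"
    and g: "g = (if odd (n + 1) then M $ 1 $ 2 div M $ 2 $ 2 else M $ 2 $ 2 div M $ 1 $ 2)"
    and C': "C' = elem_mat (prow (n + 2)) (pcol (n + 2)) (- g) ** M"
    and f: "f = q(n + 2 := g)"
  shows
    "(poly_over F g \<and>
      (\<exists>\<rho>\<in>F - {0}. \<exists>\<delta>\<in>F - {0}. r (int n) = [:\<rho>:] \<and>
         C' = const_matrix (if odd (n + 1) then mat2 \<rho> 0 0 \<delta> else mat2 0 \<delta> \<rho> 0)) \<and>
      Ct = mprod (map (\<lambda>k. elem_mat (prow k) (pcol k) (f k)) [1..<n+3]) ** C') \<and>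
     Ct = L_mat 2 1 (q 1) ** mprod (map (L_conj f) [2..<n+3]) \<and>
     C = msubst_zinv (L_mat 2 1 (q 1)) ** mprod (map (\<lambda>k. msubst_zinv (L_conj f k)) [2..<n+3]) \<and>
     factors_completely F (msubst_zinv (L_mat 2 1 (q 1))) \<and>
     (\<forall>k\<in>{2..n+2}. factors_completely F (msubst_zinv (L_conj f k))) \<and>
     factors_completely F C"
proof -
  let ?E = "\<lambda>k. elem_mat (prow k) (pcol k) (f k)"
  let ?K = "\<lambda>k. elem_mat (prow k) (pcol k) [:poly (f k) 1:]"
  note pair = pseudoidentity_pair_poly [OF F CD [folded Ct(2)]]
  have qF: "poly_over F (q k)" if "1 \<le> k" "k \<le> n + 1" for k
    using euclid that by (auto simp: euclidean_algorithm_def)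
  define R where "R = mprod (map (\<lambda>k. elem_mat (prow k) (pcol k) (- q k)) (rev [1..<n+2]))"
  have M_R: "M = R ** Ct" by (simp add: M R_def)
  have "det (mprod (map (\<lambda>k. elem_mat (prow k) (pcol k) (- q k)) ks)) = 1" for ks
    by (induction ks) (simp_all add: det_mul det_elem_mat)
  then have det_M: "det M = 1"
    by (simp add: M_R R_def det_mul pair(3) del: upt_Suc)
  \<comment> \<open>The row operations stay over F, so the entries of \<open>M\<close>, and with
    them the diagonal constants and g, lie over F.\<close>
  have "matrix_poly_over F R"
    unfolding R_def using qF F_closed(5) [OF F]
    by (auto intro!: matrix_poly_over_mprod [OF F] matrix_poly_over_elem_mat [OF F]
        simp: poly_over_def simp del: upt_Suc)
  then have M_over: "poly_over F (M $ i $ j)" for i j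
    using matrix_poly_over_mult [OF F _ pair(1)] unfolding M_R by (meson matrix_poly_over_def)

  \<comment> \<open>With the remainder 0 as term n + 1 the last division becomes a regular Euclidean step.\<close>
  define s where "s j = (if j = int n + 1 then 0 else r j)" for j
  have "M $ prow (n + 1) $ 1 = s (int (n + 1)) \<and> M $ pcol (n + 1) $ 1 = s (int (n + 1) - 1)"
  proof (rule euclid_first_column)
    show "Ct $ 1 $ 1 = s 0" "Ct $ 2 $ 1 = s (- 1)"
      using euclid by (simp_all add: Ct(1) mat2_def s_def euclidean_algorithm_def)
    show "s (int k - 2) = q k * s (int k - 1) + s (int k)" if "1 \<le> k" "k \<le> n + 1" for k
    proof (cases "k = n + 1")
      case True
      then show ?thesis using euclid by (simp add: s_def euclidean_algorithm_def)
    next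
      case False
      with that show ?thesis using euclid by (auto simp: s_def euclidean_algorithm_def)
    qed
  qed (simp add: M)
  then have col: "M $ prow (n + 1) $ 1 = 0" "M $ pcol (n + 1) $ 1 = r (int n)"
    by (simp_all add: s_def)

  \<comment> \<open>Row i contains r_n in column 1 and row j contains 0 there. The pair (i, j) is
    also the position of the last factor, the one with g.\<close>
  define i j where "i = pcol (n + 1)" and "j = prow (n + 1)"
  have ij: "odd (n + 1) \<Longrightarrow> i = 1 \<and> j = 2" "even (n + 1) \<Longrightarrow> i = 2 \<and> j = 1"
    by (simp_all add: i_def j_def prow_def pcol_def)
  \<comment> \<open>The sign of the determinant: when n + 1 is even, the nonzero product lies on the
    antidiagonal.\<close>
  define e :: complex where "e = (if odd (n + 1) then 1 else - 1)"
  have "smult e (r (int n) * M $ j $ 2) = 1"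
    using det_M col ij by (cases "odd (n + 1)") (auto simp: det_2 e_def i_def j_def mult.commute)
  moreover have "e * e = 1" by (simp add: e_def)
  ultimately have prod: "r (int n) * M $ j $ 2 = [:e:]"
    by (metis mult_1 smult_1_left smult_smult smult_one)
  have "e \<noteq> 0" "e \<in> F" using F_closed [OF F] by (auto simp: e_def)
  \<comment> \<open>Two polynomials with a nonzero constant product are themselves nonzero
    constants.\<close>
  have "degree (r (int n)) + degree (M $ j $ 2) = 0" "r (int n) \<noteq> 0" "M $ j $ 2 \<noteq> 0"
  proof -
    show *: "r (int n) \<noteq> 0" "M $ j $ 2 \<noteq> 0" using prod \<open>e \<noteq> 0\<close> by auto
    show "degree (r (int n)) + degree (M $ j $ 2) = 0"
      using degree_mult_eq [OF *] prod by simp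
  qed
  then obtain \<rho> \<delta> where \<rho>: "r (int n) = [:\<rho>:]" "\<rho> \<noteq> 0" and \<delta>: "M $ j $ 2 = [:\<delta>:]" "\<delta> \<noteq> 0"
    by (metis add_is_0 degree_eq_zeroE pCons_0_0)
  have "\<rho> \<in> F" "\<delta> \<in> F"
    using M_over [of i 1] M_over [of j 2] col(2) \<rho> \<delta> by (auto simp: poly_over_def i_def dest!: spec [of _ 0])

  \<comment> \<open>The divisor is a nonzero constant, so \<open>div\<close> is exact and only
    rescales.\<close>
  have g_eq: "g = smult (inverse \<delta>) (M $ i $ 2)"
    using g ij \<delta> div_smult_right [of _ \<delta> 1] by (cases "odd (n + 1)") auto
  have gF: "poly_over F g"
    using M_over [of i 2] \<open>\<delta> \<in> F\<close> F_closed [OF F] by (auto simp: g_eq poly_over_def)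
  have C'_ij: "C' = elem_mat i j (- g) ** M"
    by (simp add: C' i_def j_def prow_Suc pcol_Suc)
  have "g * [:\<delta>:] = M $ i $ 2"
    by (simp add: g_eq \<delta>)
  then have "C' $ i $ 2 = 0" "C' $ j $ 2 = [:\<delta>:]" "C' $ i $ 1 = [:\<rho>:]" "C' $ j $ 1 = 0"
    using col \<delta> \<rho>
    by (simp_all add: C'_ij elem_mat_mult_nth flip: i_def j_def) (simp_all add: i_def j_def)
  then have C'_const: "C' = const_matrix (if odd (n + 1) then mat2 \<rho> 0 0 \<delta> else mat2 0 \<delta> \<rho> 0)"
    using ij by (cases "odd (n + 1)")
      (auto simp: vec_eq_iff forall_2 const_matrix_def mat2_def)

  have inv: "mprod (map ?E [1..<n+3]) ** mprod (map (\<lambda>k. elem_mat (prow k) (pcol k) (- f k)) (rev [1..<n+3])) = mat 1"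
    by (rule mprod_inverse) (simp add: elem_mat_mult)
  \<comment> \<open>The inverse of the full elementary product is exactly the row reduction taking
    \<open>Ct\<close> to \<open>C'\<close>, including the final step with g.\<close>
  have "mprod (map (\<lambda>k. elem_mat (prow k) (pcol k) (- f k)) (rev [1..<n+3])) =
      elem_mat (prow (n + 2)) (pcol (n + 2)) (- g) ** R"
  proof -
    have "map (\<lambda>k. elem_mat (prow k) (pcol k) (- f k)) (rev [1..<n+2]) =
        map (\<lambda>k. elem_mat (prow k) (pcol k) (- q k)) (rev [1..<n+2])"
      by (rule map_cong) (auto simp: f)
    moreover have "rev [1..<n+3] = (n + 2) # rev [1..<n+2]"
      by (simp add: numeral_3_eq_3)
    moreover have "f (n + 2) = g" by (simp add: f)
    ultimately show ?thesis by (simp only: R_def list.map mprod_Cons)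
  qed
  then have Ct_E: "Ct = mprod (map ?E [1..<n+3]) ** C'"
    using inv by (simp add: C' M_R matrix_mul_assoc)

  let ?ev = "map_matrix (\<lambda>p :: complex poly. poly p 1)"
  \<comment> \<open>The matrix \<open>C'\<close> is constant and \<open>?K k\<close> is the value of
    \<open>?E k\<close> at t = 1, so the left side is C(1). This is why the constants and
    \<open>C'\<close> together disappear from the factorization.\<close>
  have "mprod (map ?K [1..<n+3]) ** C' =
      const_matrix (?ev (mprod (map ?E [1..<n+3]) ** C'))"
  proof -
    have "?K k = const_matrix (?ev (?E k))" for k
      by (simp add: vec_eq_iff const_matrix_def elem_mat_nth one_pCons)
    moreover have "C' = const_matrix (?ev C')"
      by (simp add: C'_const const_matrix_def vec_eq_iff)
    ultimately show ?thesis
      by (simp add: const_matrix_def poly_at.map_matrix_mult poly_at.map_matrix_mprod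
          const_poly.map_matrix_mult const_poly.map_matrix_mprod comp_def)
  qed
  also have "\<dots> = mat 1"
    unfolding Ct_E [symmetric] pair(2) const_matrix_def by (rule const_poly.map_matrix_one)
  finally have at_1: "mprod (map ?K [1..<n+3]) ** C' = mat 1" .
  have "Ct = mprod (map (L_conj f) [1..<n+3]) ** (mprod (map ?K [1..<n+3]) ** C')"
    using Ct_E mprod_elem_mat_eq_mprod_L_conj [of f "n + 2"]
    by (simp add: matrix_mul_assoc numeral_3_eq_3)
  then have "Ct = mprod (map (L_conj f) [1..<n+3])"
    by (simp only: at_1 matrix_mul_rid)
  moreover have "[1..<n+3] = 1 # [2..<n+3]"
    by (simp add: upt_conv_Cons numeral_2_eq_2)
  \<comment> \<open>The first factor has no predecessors, so its conjugating products are empty; n +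
    2 is never 1, so \<open>f 1\<close> is \<open>q 1\<close>.\<close>
  moreover have L_1: "L_conj f 1 = L_mat 2 1 (q 1)"
    by (simp add: L_conj_def f prow_def pcol_def)
  ultimately have Ct_L: "Ct = L_mat 2 1 (q 1) ** mprod (map (L_conj f) [2..<n+3])"
    by (simp only: list.map mprod_Cons)
  then have C_L: "C = msubst_zinv (L_mat 2 1 (q 1)) ** mprod (map (\<lambda>k. msubst_zinv (L_conj f k)) [2..<n+3])"
    by (simp add: msubst_zinv_mult msubst_zinv_mprod comp_def flip: Ct(2))

  have fF: "poly_over F (f k)" if "1 \<le> k" "k \<le> n + 2" for k
    using that qF gF by (auto simp: f)
  have fac: "factors_completely F (msubst_zinv (L_conj f k))" if "1 \<le> k" "k \<le> n + 2" for k
    using that fF by (intro factors_completely_L_conj [OF F]) auto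
  have fac_1: "factors_completely F (msubst_zinv (L_mat 2 1 (q 1)))"
    using fac [of 1] L_1 by simp
  have "factors_completely F C"
    unfolding C_L using fac fac_1
    by (auto intro!: factors_completely_mult [OF F] factors_completely_mprod [OF F])
  then show ?thesis
    using gF \<rho> \<delta> \<open>\<rho> \<in> F\<close> \<open>\<delta> \<in> F\<close> C'_const Ct_E Ct_L C_L fac fac_1 by auto
qed

end
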